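(* Let $\tau$ be a finite unary vocabulary, $c_\tau := 15|\tau|2^{|\tau|}$, $d$ a positive integer, $\mathfrak{M}$ a $\tau$-model of size $n$, and $h\in\{1,\dots,d-1\}$. If $H_B^d(\mathfrak{M}) < \log\binom{n}{h}$, then $C_d(\mathfrak{M}) < 6h + c_\tau$.
   Context: All logarithms are base 2. A $\tau$-model of size $n$ has domain $\{1,\dots,n\}$ and interprets each unary symbol as a subset. A type is a subset $\pi\subseteq\tau$; $|\pi|_{\mathfrak{M}}$ is the number of points in exactly the relations named in $\pi$. For models of size $n$, $\mathfrak{M}\equiv_d\mathfrak{M}'$ iff every type $\pi$ with $|\pi|_{\mathfrak{M}}<d$ has $|\pi|_{\mathfrak{M}}=|\pi|_{\mathfrak{M}'}$. $H_B^d(\mathfrak{M}) = \log|\mathcal{M}|$ where $\mathcal{M}$ is the $\equiv_d$-class of $\mathfrak{M}$ among $\tau$-models with domain $\{1,\dots,n\}$. $\mathrm{FO}_d[\tau]$ is first-order logic (negation normal form) of quantifier rank at most $d$; size counts atomic formulas (negated or not), conjunctions, disjunctions and quantifiers, not negations. $C_d(\mathfrak{M})$ is the minimum size of an $\mathrm{FO}_d[\tau]$-sentence true in exactly the $\tau$-models of size $n$ that are $\equiv_d$-equivalent to $\mathfrak{M}$. *)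

theory Defs
  imports Complex_Main "HOL-Library.FuncSet" "HOL-Library.Extended_Nat"
begin

section \<open>Models of a unary vocabulary\<close>

text \<open>A vocabulary is a finite set \<open>\<tau>\<close> of unary relation symbols. The extensional function space
  gives exactly one function for each model, so that models can be counted.\<close>

definition models :: "'p set \<Rightarrow> nat \<Rightarrow> ('p \<Rightarrow> nat set) set" where
  "models \<tau> n = (\<tau> \<rightarrow>\<^sub>E Pow {1..n})"

definition type_count :: "'p set \<Rightarrow> nat \<Rightarrow> ('p \<Rightarrow> nat set) \<Rightarrow> 'p set \<Rightarrow> nat" where
  "type_count \<tau> n M \<pi> = card {a \<in> {1..n}. \<forall>P\<in>\<tau>. a \<in> M P \<longleftrightarrow> P \<in> \<pi>}"

definition d_agrees :: "nat \<Rightarrow> 'p set \<Rightarrow> nat \<Rightarrow> ('p \<Rightarrow> nat set) \<Rightarrow> ('p \<Rightarrow> nat set) \<Rightarrow> bool" where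
  "d_agrees d \<tau> n M M' \<longleftrightarrow>
     (\<forall>\<pi>. \<pi> \<subseteq> \<tau> \<longrightarrow> type_count \<tau> n M \<pi> < d \<longrightarrow> type_count \<tau> n M \<pi> = type_count \<tau> n M' \<pi>)"

text \<open>On its own, \<open>d_agrees\<close> is not symmetric: if two types have at least \<open>d\<close> points in \<open>M\<close>, then
  \<open>M'\<close> may have fewer than \<open>d\<close> points in one of them. It is required in both directions, so that
  the relation is an equivalence: every type has the same number of points in both models, or at
  least \<open>d\<close> points in both.\<close>

definition d_equiv :: "nat \<Rightarrow> 'p set \<Rightarrow> nat \<Rightarrow> ('p \<Rightarrow> nat set) \<Rightarrow> ('p \<Rightarrow> nat set) \<Rightarrow> bool" where
  "d_equiv d \<tau> n M M' \<longleftrightarrow> d_agrees d \<tau> n M M' \<and> d_agrees d \<tau> n M' M"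

lemma d_equiv_iff:
  "d_equiv d \<tau> n M M' \<longleftrightarrow>
     (\<forall>\<pi>. \<pi> \<subseteq> \<tau> \<longrightarrow> type_count \<tau> n M \<pi> = type_count \<tau> n M' \<pi> \<or>
        (d \<le> type_count \<tau> n M \<pi> \<and> d \<le> type_count \<tau> n M' \<pi>))"
proof -
  have "((a < d \<longrightarrow> a = b) \<and> (b < d \<longrightarrow> b = a)) \<longleftrightarrow> (a = b \<or> (d \<le> a \<and> d \<le> b))" for a b :: nat
    by auto
  then show ?thesis
    unfolding d_equiv_def d_agrees_def by blast
qed

lemma equivp_d_equiv: "equivp (d_equiv d \<tau> n)"
proof (rule equivpI)
  show "reflp (d_equiv d \<tau> n)"
    by (simp add: reflp_def d_equiv_def d_agrees_def)
  show "symp (d_equiv d \<tau> n)"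
    by (auto simp: symp_def d_equiv_def)
  show "transp (d_equiv d \<tau> n)"
  proof (rule transpI)
    fix A B C
    assume AB: "d_equiv d \<tau> n A B" and BC: "d_equiv d \<tau> n B C"
    show "d_equiv d \<tau> n A C"
      unfolding d_equiv_iff
    proof (intro allI impI)
      fix \<pi> assume sub: "\<pi> \<subseteq> \<tau>"
      have 1: "type_count \<tau> n A \<pi> = type_count \<tau> n B \<pi> \<or>
          (d \<le> type_count \<tau> n A \<pi> \<and> d \<le> type_count \<tau> n B \<pi>)"
        using AB sub unfolding d_equiv_iff by blast
      have 2: "type_count \<tau> n B \<pi> = type_count \<tau> n C \<pi> \<or>
          (d \<le> type_count \<tau> n B \<pi> \<and> d \<le> type_count \<tau> n C \<pi>)"
        using BC sub unfolding d_equiv_iff by blast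
      show "type_count \<tau> n A \<pi> = type_count \<tau> n C \<pi> \<or>
          (d \<le> type_count \<tau> n A \<pi> \<and> d \<le> type_count \<tau> n C \<pi>)"
        using 1 2 by linarith
    qed
  qed
qed

definition d_class :: "nat \<Rightarrow> 'p set \<Rightarrow> nat \<Rightarrow> ('p \<Rightarrow> nat set) \<Rightarrow> ('p \<Rightarrow> nat set) set" where
  "d_class d \<tau> n M = {M' \<in> models \<tau> n. d_equiv d \<tau> n M M'}"

definition boltzmann_entropy :: "nat \<Rightarrow> 'p set \<Rightarrow> nat \<Rightarrow> ('p \<Rightarrow> nat set) \<Rightarrow> real" where
  "boltzmann_entropy d \<tau> n M = log 2 (real (card (d_class d \<tau> n M)))"

section \<open>First-order logic with equality in negation normal form\<close>

text \<open>Variables are natural numbers; \<open>preds \<phi>\<close> is the set of relation symbols occurring in \<open>\<phi>\<close>.\<close>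

datatype (preds: 'p) fo =
    Pred 'p nat | NPred 'p nat
  | Eq nat nat | NEq nat nat
  | And "'p fo" "'p fo" | Or "'p fo" "'p fo"
  | Ex nat "'p fo" | All nat "'p fo"

primrec fv :: "'p fo \<Rightarrow> nat set" where
  "fv (Pred P x) = {x}"
| "fv (NPred P x) = {x}"
| "fv (Eq x y) = {x, y}"
| "fv (NEq x y) = {x, y}"
| "fv (And \<phi> \<psi>) = fv \<phi> \<union> fv \<psi>"
| "fv (Or \<phi> \<psi>) = fv \<phi> \<union> fv \<psi>"
| "fv (Ex x \<phi>) = fv \<phi> - {x}"
| "fv (All x \<phi>) = fv \<phi> - {x}"

primrec qrank :: "'p fo \<Rightarrow> nat" where
  "qrank (Pred P x) = 0"
| "qrank (NPred P x) = 0"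
| "qrank (Eq x y) = 0"
| "qrank (NEq x y) = 0"
| "qrank (And \<phi> \<psi>) = max (qrank \<phi>) (qrank \<psi>)"
| "qrank (Or \<phi> \<psi>) = max (qrank \<phi>) (qrank \<psi>)"
| "qrank (Ex x \<phi>) = Suc (qrank \<phi>)"
| "qrank (All x \<phi>) = Suc (qrank \<phi>)"

primrec fo_size :: "'p fo \<Rightarrow> nat" where
  "fo_size (Pred P x) = 1"
| "fo_size (NPred P x) = 1"
| "fo_size (Eq x y) = 1"
| "fo_size (NEq x y) = 1"
| "fo_size (And \<phi> \<psi>) = fo_size \<phi> + fo_size \<psi> + 1"
| "fo_size (Or \<phi> \<psi>) = fo_size \<phi> + fo_size \<psi> + 1"
| "fo_size (Ex x \<phi>) = fo_size \<phi> + 1"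
| "fo_size (All x \<phi>) = fo_size \<phi> + 1"

primrec sat :: "nat \<Rightarrow> ('p \<Rightarrow> nat set) \<Rightarrow> (nat \<Rightarrow> nat) \<Rightarrow> 'p fo \<Rightarrow> bool" where
  "sat n M \<sigma> (Pred P x) \<longleftrightarrow> \<sigma> x \<in> M P"
| "sat n M \<sigma> (NPred P x) \<longleftrightarrow> \<sigma> x \<notin> M P"
| "sat n M \<sigma> (Eq x y) \<longleftrightarrow> \<sigma> x = \<sigma> y"
| "sat n M \<sigma> (NEq x y) \<longleftrightarrow> \<sigma> x \<noteq> \<sigma> y"
| "sat n M \<sigma> (And \<phi> \<psi>) \<longleftrightarrow> sat n M \<sigma> \<phi> \<and> sat n M \<sigma> \<psi>"
| "sat n M \<sigma> (Or \<phi> \<psi>) \<longleftrightarrow> sat n M \<sigma> \<phi> \<or> sat n M \<sigma> \<psi>"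
| "sat n M \<sigma> (Ex x \<phi>) \<longleftrightarrow> (\<exists>a\<in>{1..n}. sat n M (\<sigma>(x := a)) \<phi>)"
| "sat n M \<sigma> (All x \<phi>) \<longleftrightarrow> (\<forall>a\<in>{1..n}. sat n M (\<sigma>(x := a)) \<phi>)"

definition true_in :: "nat \<Rightarrow> ('p \<Rightarrow> nat set) \<Rightarrow> 'p fo \<Rightarrow> bool" where
  "true_in n M \<phi> \<longleftrightarrow> (\<forall>\<sigma>. range \<sigma> \<subseteq> {1..n} \<longrightarrow> sat n M \<sigma> \<phi>)"

definition FO_sentences :: "nat \<Rightarrow> 'p set \<Rightarrow> 'p fo set" where
  "FO_sentences d \<tau> = {\<phi>. preds \<phi> \<subseteq> \<tau> \<and> fv \<phi> = {} \<and> qrank \<phi> \<le> d}"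

text \<open>The minimum is taken in \<^typ>\<open>enat\<close>, so that it would be \<open>\<infinity>\<close>, not \<open>0\<close>, if there were no
  defining sentence.\<close>

definition description_complexity :: "nat \<Rightarrow> 'p set \<Rightarrow> nat \<Rightarrow> ('p \<Rightarrow> nat set) \<Rightarrow> enat" where
  "description_complexity d \<tau> n M =
     (INF \<phi> \<in> {\<phi> \<in> FO_sentences d \<tau>.
                 \<forall>M'\<in>models \<tau> n. true_in n M' \<phi> \<longleftrightarrow> d_equiv d \<tau> n M M'}. enat (fo_size \<phi>))"

definition c_voc :: "'p set \<Rightarrow> nat" where
  "c_voc \<tau> = 15 * card \<tau> * 2 ^ card \<tau>"

end

theory Submission
  imports Defs "HOL-Combinatorics.Multiset_Permutations"
begin

text \<open>The models with the same type counts \<open>n\<^sub>\<pi>\<close> as \<open>M\<close> all lie in the class of \<open>M\<close>, so the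
  class has at least \<open>n! / \<Prod>n\<^sub>\<pi>!\<close> elements. If all counts were at most \<open>max h (n - h)\<close>, then
  \<open>\<Prod>n\<^sub>\<pi>! \<le> h! (n - h)!\<close>, contradicting the entropy bound. Hence one type has more than \<open>n - h\<close>
  points, and the other types together have fewer than \<open>h < d\<close> points. It suffices to fix the
  counts of these other types, since the domain size determines the remaining one. Having exactly
  \<open>m\<close> points of a type is expressed by ``at most \<open>m\<close>'' and ``not at most \<open>m - 1\<close>'', at a cost of
  \<open>3m\<close> each, up to a constant: \<open>\<exists>x\<^sub>1\<dots>x\<^sub>m \<forall>y (\<not>\<pi>(y) \<or> y = x\<^sub>1 \<or> \<dots> \<or> y = x\<^sub>m)\<close>.\<close>

section \<open>Factorials and multinomial coefficients\<close>

lemma fact_mult_le_fact_add: "fact a * fact b \<le> (fact (a + b) :: nat)"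
proof -
  have "(fact (a + b) :: nat) = fact a * fact b * ((a + b) choose a)"
    using binomial_fact_lemma[of a "a + b"] by simp
  moreover have "(a + b) choose a > 0"
    by simp
  ultimately show ?thesis
    by (metis One_nat_def Suc_leI mult.right_neutral mult_le_mono2)
qed

lemma prod_fact_le_fact_sum: "finite A \<Longrightarrow> (\<Prod>i\<in>A. fact (f i)) \<le> (fact (\<Sum>i\<in>A. f i) :: nat)"
proof (induction A rule: finite_induct)
  case (insert x A)
  have "(\<Prod>i\<in>insert x A. fact (f i)) \<le> (fact (f x) * fact (\<Sum>i\<in>A. f i) :: nat)"
    using insert by simp
  also have "\<dots> \<le> fact (f x + (\<Sum>i\<in>A. f i))"
    by (rule fact_mult_le_fact_add)
  finally show ?case
    using insert by simp
qed simp

text \<open>After division, both sides are products of \<open>c\<close> consecutive integers,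
  starting above \<open>a\<close> and above \<open>b\<close>; the later start gives the larger
  product.\<close>

lemma fact_mult_add_le: "a \<le> b \<Longrightarrow> fact (a + c) * fact b \<le> (fact a * fact (b + c) :: nat)"
proof (induction c)
  case (Suc c)
  have "fact (a + Suc c) * fact b = Suc (a + c) * (fact (a + c) * fact b :: nat)"
    by (simp add: algebra_simps)
  also have "\<dots> \<le> Suc (b + c) * (fact a * fact (b + c))"
    by (rule mult_le_mono) (use Suc in simp_all)
  also have "\<dots> = fact a * fact (b + Suc c)"
    by (simp add: algebra_simps)
  finally show ?case .
qed simp

text \<open>Factorials are log-convex, so pushing the parts of a fixed sum to extremes increases the
  product. With parts capped at \<open>N\<close>, one part \<open>N\<close> and one part
  \<open>m\<close> therefore give an upper bound.\<close>

lemma prod_fact_le: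
  assumes "finite A" "\<And>i. i \<in> A \<Longrightarrow> f i \<le> N" "(\<Sum>i\<in>A. f i) = m + N"
  shows "(\<Prod>i\<in>A. fact (f i)) \<le> (fact m * fact N :: nat)"
  using assms
proof (induction A arbitrary: m rule: finite_induct)
  case (insert x A)
  let ?s = "\<Sum>i\<in>A. f i"
  have tot: "f x + ?s = m + N" and x: "f x \<le> N"
    using insert by auto
  have split: "(\<Prod>i\<in>insert x A. fact (f i)) = (fact (f x) * (\<Prod>i\<in>A. fact (f i)) :: nat)"
    using insert by simp
  show ?case
  proof (cases "N \<le> ?s")
    \<comment> \<open>The remaining parts already fill a block \<open>N\<close>; their excess over
      \<open>N\<close> merges with \<open>f x\<close>.\<close>
    case True
    then have "?s = (?s - N) + N"
      by simp
    then have "(\<Prod>i\<in>A. fact (f i)) \<le> (fact (?s - N) * fact N :: nat)"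
      using insert by blast
    then have "fact (f x) * (\<Prod>i\<in>A. fact (f i)) \<le> (fact (f x) * fact (?s - N) * fact N :: nat)"
      by (simp add: mult.assoc)
    also have "\<dots> \<le> fact (f x + (?s - N)) * fact N"
      by (intro mult_le_mono fact_mult_le_fact_add) simp
    also have "f x + (?s - N) = m"
      using tot True by simp
    finally show ?thesis
      using split by simp
  next
    case False
    have "fact (f x) * (\<Prod>i\<in>A. fact (f i)) \<le> (fact (f x) * fact ?s :: nat)"
      using prod_fact_le_fact_sum[OF \<open>finite A\<close>] by simp
    also have "\<dots> \<le> fact m * fact N"
    proof -
      \<comment> \<open>The remaining parts merge into \<open>?s < N\<close>; moving
        \<open>f x - m\<close> from \<open>f x\<close> over to \<open>?s\<close> raises it to
        exactly \<open>N\<close>.\<close>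
      have "f x = m + (f x - m)" "N = ?s + (f x - m)" "m \<le> ?s"
        using tot x False by linarith+
      then show ?thesis
        using fact_mult_add_le[of m ?s "f x - m"] by simp
    qed
    finally show ?thesis
      using split by simp
  qed
qed simp

section \<open>Counting the models in a class\<close>

text \<open>A model becomes a word of length \<open>n\<close> over the types, so that models with
  equal counts are rearrangements of one word.\<close>

definition type_list :: "'p set \<Rightarrow> nat \<Rightarrow> ('p \<Rightarrow> nat set) \<Rightarrow> 'p set list" where
  "type_list \<tau> n M = map (\<lambda>a. {P \<in> \<tau>. a \<in> M P}) [1..<Suc n]"

lemma count_type_list:
  assumes "\<pi> \<subseteq> \<tau>"
  shows "count (mset (type_list \<tau> n M)) \<pi> = type_count \<tau> n M \<pi>"
proof -
  have "{a \<in> {1..<Suc n}. {P \<in> \<tau>. a \<in> M P} = \<pi>} = {a \<in> {1..n}. \<forall>P\<in>\<tau>. a \<in> M P \<longleftrightarrow> P \<in> \<pi>}"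
    using assms by auto
  moreover have "mset (type_list \<tau> n M) = image_mset (\<lambda>a. {P \<in> \<tau>. a \<in> M P}) (mset_set {1..<Suc n})"
    by (simp add: type_list_def del: upt_Suc)
  ultimately show ?thesis
    by (simp add: type_count_def count_image_mset_eq_card_vimage)
qed

lemma length_type_list [simp]: "length (type_list \<tau> n M) = n"
  by (simp add: type_list_def)

lemma set_type_list: "set (type_list \<tau> n M) \<subseteq> Pow \<tau>"
  by (auto simp: type_list_def)

lemma sum_type_count:
  assumes "finite \<tau>"
  shows "(\<Sum>\<pi>\<in>Pow \<tau>. type_count \<tau> n M \<pi>) = n"
proof -
  have "(\<Sum>\<pi>\<in>Pow \<tau>. type_count \<tau> n M \<pi>) = (\<Sum>\<pi>\<in>Pow \<tau>. count_list (type_list \<tau> n M) \<pi>)"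
    by (intro sum.cong refl) (simp add: count_type_list flip: count_mset)
  also have "\<dots> = length (type_list \<tau> n M)"
    using assms set_type_list by (intro sum_count_set) simp_all
  finally show ?thesis
    by simp
qed

lemma finite_models: "finite \<tau> \<Longrightarrow> finite (models \<tau> n)"
  by (simp add: models_def finite_PiE)

text \<open>Every rearrangement of the type list comes from a model with the same counts, hence from
  a member of the class. The multinomial coefficient counts these rearrangements; it is written as a
  product to avoid division.\<close>

lemma fact_le_card_d_class:
  assumes "finite \<tau>"
  shows "fact n \<le> card (d_class d \<tau> n M) * (\<Prod>\<pi>\<in>Pow \<tau>. fact (type_count \<tau> n M \<pi>))"
proof -
  let ?L = "mset (type_list \<tau> n M)"
  have "permutations_of_multiset ?L \<subseteq> type_list \<tau> n ` d_class d \<tau> n M"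
  proof
    fix xs assume "xs \<in> permutations_of_multiset ?L"
    then have xs: "mset xs = ?L"
      by (rule permutations_of_multisetD)
    have len: "length xs = n"
      using mset_eq_length[OF xs] by simp
    have sub: "xs ! i \<subseteq> \<tau>" if "i < n" for i
      using that len mset_eq_setD[OF xs] set_type_list[of \<tau> n M] nth_mem[of i xs] by auto
    \<comment> \<open>Points start at 1 and list positions at 0, hence \<open>a - 1\<close>; the
      restricted abstraction makes \<open>M'\<close> extensional.\<close>
    define M' where "M' = (\<lambda>P\<in>\<tau>. {a \<in> {1..n}. P \<in> xs ! (a - 1)})"
    have "M' \<in> models \<tau> n"
      by (auto simp: M'_def models_def)
    moreover have tl: "type_list \<tau> n M' = xs"
      using len sub by (intro nth_equalityI) (auto simp: type_list_def M'_def simp del: upt_Suc)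
    moreover have "d_equiv d \<tau> n M M'"
      unfolding d_equiv_iff using xs tl count_type_list by metis
    ultimately show "xs \<in> type_list \<tau> n ` d_class d \<tau> n M"
      by (auto simp: d_class_def)
  qed
  moreover have fin: "finite (d_class d \<tau> n M)"
    using finite_models[OF assms] by (auto simp: d_class_def)
  ultimately have le: "card (permutations_of_multiset ?L) \<le> card (d_class d \<tau> n M)"
    by (meson card_image_le card_mono finite_imageI order_trans)
  \<comment> \<open>Types that do not occur contribute \<open>fact 0 = 1\<close>.\<close>
  have "(\<Prod>\<pi>\<in>set_mset ?L. fact (count ?L \<pi>)) = (\<Prod>\<pi>\<in>Pow \<tau>. fact (count ?L \<pi>) :: nat)"
    using assms set_type_list[of \<tau> n M] by (intro prod.mono_neutral_left) (auto simp: count_mset)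
  also have "\<dots> = (\<Prod>\<pi>\<in>Pow \<tau>. fact (type_count \<tau> n M \<pi>))"
    by (intro prod.cong refl) (simp add: count_type_list)
  finally have "fact n = card (permutations_of_multiset ?L) * (\<Prod>\<pi>\<in>Pow \<tau>. fact (type_count \<tau> n M \<pi>))"
    using card_permutations_of_multiset_aux[of ?L] by simp
  then show ?thesis
    using le by simp
qed

lemma dominant_type:
  assumes "finite \<tau>" "h \<le> n" "h > 0" "card (d_class d \<tau> n M) < n choose h"
  obtains \<pi> where "\<pi> \<subseteq> \<tau>" "n - type_count \<tau> n M \<pi> < h"
proof -
  \<comment> \<open>The cap is a maximum because \<open>h\<close> may exceed half of
    \<open>n\<close>; its complement in \<open>n\<close> is then \<open>min h (n - h)\<close>, and
    the two factorials multiply to \<open>fact h * fact (n - h)\<close> in either case.\<close>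
  let ?c = "type_count \<tau> n M" and ?N = "max h (n - h)"
  have "\<exists>\<pi>\<in>Pow \<tau>. ?N < ?c \<pi>"
  proof (rule ccontr)
    assume "\<not> (\<exists>\<pi>\<in>Pow \<tau>. ?N < ?c \<pi>)"
    then have "(\<Prod>\<pi>\<in>Pow \<tau>. fact (?c \<pi>)) \<le> (fact (min h (n - h)) * fact ?N :: nat)"
      using assms sum_type_count[OF assms(1)] by (intro prod_fact_le) (auto simp: not_less le_max_iff_disj)
    also have "\<dots> = fact h * fact (n - h)"
      by (simp add: min_def max_def)
    finally have le: "(\<Prod>\<pi>\<in>Pow \<tau>. fact (?c \<pi>)) \<le> (fact h * fact (n - h) :: nat)" .
    have "(fact n :: nat) \<le> card (d_class d \<tau> n M) * (\<Prod>\<pi>\<in>Pow \<tau>. fact (?c \<pi>))"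
      using assms by (intro fact_le_card_d_class)
    also have "\<dots> \<le> card (d_class d \<tau> n M) * (fact h * fact (n - h))"
      using le by simp
    also have "\<dots> < (n choose h) * (fact h * fact (n - h))"
      using assms by simp
    also have "\<dots> = fact n"
      using binomial_fact_lemma[OF assms(2)] by (simp add: mult.commute)
    finally show False
      by simp
  qed
  then obtain \<pi> where "\<pi> \<subseteq> \<tau>" "?N < ?c \<pi>"
    by blast
  moreover from this assms(2,3) have "n - ?c \<pi> < h"
    by auto
  ultimately show thesis
    by (intro that)
qed

section \<open>Counting sentences\<close>

text \<open>The syntax has no negation, so the dual formula stands in for it; it costs nothing,
  since negated and plain atoms have equal size.\<close>

primrec neg :: "'p fo \<Rightarrow> 'p fo" where
  "neg (Pred P x) = NPred P x"
| "neg (NPred P x) = Pred P x"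
| "neg (Eq x y) = NEq x y"
| "neg (NEq x y) = Eq x y"
| "neg (And \<phi> \<psi>) = Or (neg \<phi>) (neg \<psi>)"
| "neg (Or \<phi> \<psi>) = And (neg \<phi>) (neg \<psi>)"
| "neg (Ex x \<phi>) = All x (neg \<phi>)"
| "neg (All x \<phi>) = Ex x (neg \<phi>)"

lemma sat_neg [simp]: "sat n M \<sigma> (neg \<phi>) \<longleftrightarrow> \<not> sat n M \<sigma> \<phi>"
  by (induction \<phi> arbitrary: \<sigma>) auto

lemma neg_measures [simp]:
  "preds (neg \<phi>) = preds \<phi>" "fv (neg \<phi>) = fv \<phi>" "qrank (neg \<phi>) = qrank \<phi>"
  "fo_size (neg \<phi>) = fo_size \<phi>"
  by (induction \<phi>) auto

text \<open>Variable 0 stays outside the block, reserved for the point \<open>y\<close> that is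
  tested against the witnesses.\<close>

primrec ex_block :: "nat \<Rightarrow> 'p fo \<Rightarrow> 'p fo" where
  "ex_block 0 \<phi> = \<phi>"
| "ex_block (Suc m) \<phi> = Ex (Suc m) (ex_block m \<phi>)"

lemma ex_block_measures [simp]:
  "preds (ex_block m \<phi>) = preds \<phi>" "fv (ex_block m \<phi>) = fv \<phi> - {1..m}"
  "qrank (ex_block m \<phi>) = m + qrank \<phi>" "fo_size (ex_block m \<phi>) = m + fo_size \<phi>"
  by (induction m) auto

lemma sat_ex_block:
  "sat n M \<sigma> (ex_block m \<phi>) \<longleftrightarrow>
     (\<exists>\<sigma>'. (\<forall>i. i \<notin> {1..m} \<longrightarrow> \<sigma>' i = \<sigma> i) \<and> \<sigma>' ` {1..m} \<subseteq> {1..n} \<and> sat n M \<sigma>' \<phi>)"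
proof (induction m arbitrary: \<sigma>)
  case 0
  have "(\<forall>i. \<sigma>' i = \<sigma> i) \<longleftrightarrow> \<sigma>' = \<sigma>" for \<sigma>' :: "nat \<Rightarrow> nat"
    by auto
  then show ?case
    by simp
next
  case (Suc m)
  \<comment> \<open>The outermost quantifier fixes the value at \<open>Suc m\<close>; for a given
    final assignment this value can only be \<open>\<sigma>' (Suc m)\<close>.\<close>
  have "(\<exists>a\<in>{1..n}. (\<forall>i. i \<notin> {1..m} \<longrightarrow> \<sigma>' i = (\<sigma>(Suc m := a)) i) \<and> \<sigma>' ` {1..m} \<subseteq> {1..n})
      \<longleftrightarrow> (\<forall>i. i \<notin> {1..Suc m} \<longrightarrow> \<sigma>' i = \<sigma> i) \<and> \<sigma>' ` {1..Suc m} \<subseteq> {1..n}" (is "?L \<longleftrightarrow> ?R")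
    for \<sigma>'
  proof
    assume ?L
    moreover have "{1..Suc m} = insert (Suc m) {1..m}"
      by auto
    ultimately show ?R
      by auto
  next
    assume R: ?R
    have "\<sigma>' (Suc m) \<in> \<sigma>' ` {1..Suc m}"
      by (intro imageI) simp
    with R have "\<sigma>' (Suc m) \<in> {1..n}"
      by (meson subsetD)
    moreover have "\<forall>i. i \<notin> {1..m} \<longrightarrow> \<sigma>' i = (\<sigma>(Suc m := \<sigma>' (Suc m))) i"
      using R by (auto simp: le_Suc_eq)
    moreover have "\<sigma>' ` {1..m} \<subseteq> {1..n}"
      using R by auto
    ultimately show ?L
      by (intro bexI[of _ "\<sigma>' (Suc m)"] conjI)
  qed
  moreover have "sat n M \<sigma> (ex_block (Suc m) \<phi>) \<longleftrightarrow>
      (\<exists>\<sigma>'. (\<exists>a\<in>{1..n}. (\<forall>i. i \<notin> {1..m} \<longrightarrow> \<sigma>' i = (\<sigma>(Suc m := a)) i) \<and> \<sigma>' ` {1..m} \<subseteq> {1..n}) \<and>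
        sat n M \<sigma>' \<phi>)"
    unfolding ex_block.simps sat.simps Suc.IH
    by (rule iffI; elim exE bexE conjE; intro exI bexI conjI; assumption)
  ultimately show ?case
    by simp
qed

section \<open>Sentences that bound and fix the number of points of a type\<close>

abbreviation Ors :: "'p fo list \<Rightarrow> 'p fo \<Rightarrow> 'p fo" where
  "Ors \<phi>s \<phi> \<equiv> foldr Or \<phi>s \<phi>"

lemma sat_Ors: "sat n M \<sigma> (Ors \<phi>s \<phi>) \<longleftrightarrow> (\<exists>\<psi>\<in>set \<phi>s. sat n M \<sigma> \<psi>) \<or> sat n M \<sigma> \<phi>"
  by (induction \<phi>s) auto

lemma Ors_measures:
  "preds (Ors \<phi>s \<phi>) = (\<Union>\<psi>\<in>set \<phi>s. preds \<psi>) \<union> preds \<phi>"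
  "fv (Ors \<phi>s \<phi>) = (\<Union>\<psi>\<in>set \<phi>s. fv \<psi>) \<union> fv \<phi>"
  "(\<And>\<psi>. \<psi> \<in> set \<phi>s \<Longrightarrow> qrank \<psi> \<le> q) \<Longrightarrow> qrank \<phi> \<le> q \<Longrightarrow> qrank (Ors \<phi>s \<phi>) \<le> q"
  "fo_size (Ors \<phi>s \<phi>) = (\<Sum>\<psi>\<leftarrow>\<phi>s. fo_size \<psi> + 1) + fo_size \<phi>"
  by (induction \<phi>s) auto

text \<open>\<open>NEq 0 0\<close> serves as falsity, the neutral element of the disjunction, and
  yields a formula even for an empty vocabulary.\<close>

definition not_of_type :: "'p list \<Rightarrow> 'p set \<Rightarrow> 'p fo" where
  "not_of_type Ps \<pi> = Ors (map (\<lambda>P. if P \<in> \<pi> then NPred P 0 else Pred P 0) Ps) (NEq 0 0)"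

lemma sat_not_of_type:
  "sat n M \<sigma> (not_of_type Ps \<pi>) \<longleftrightarrow> \<not> (\<forall>P\<in>set Ps. \<sigma> 0 \<in> M P \<longleftrightarrow> P \<in> \<pi>)"
  by (induction Ps) (simp_all add: not_of_type_def)

lemma not_of_type_measures:
  "preds (not_of_type Ps \<pi>) \<subseteq> set Ps" "fv (not_of_type Ps \<pi>) = {0}"
  "qrank (not_of_type Ps \<pi>) = 0" "fo_size (not_of_type Ps \<pi>) = 2 * length Ps + 1"
proof -
  have "qrank (not_of_type Ps \<pi>) \<le> 0"
    unfolding not_of_type_def by (rule Ors_measures) auto
  then show "qrank (not_of_type Ps \<pi>) = 0"
    by simp
  show "fo_size (not_of_type Ps \<pi>) = 2 * length Ps + 1"
    unfolding not_of_type_def by (induction Ps) auto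
qed (auto simp: not_of_type_def Ors_measures split: if_splits)

text \<open>The witnesses may coincide, so no pairwise inequalities are required and the size stays
  linear in \<open>m\<close>.\<close>

definition at_most :: "'p list \<Rightarrow> 'p set \<Rightarrow> nat \<Rightarrow> 'p fo" where
  "at_most Ps \<pi> m =
     ex_block m (All 0 (Ors (map (\<lambda>i. Eq 0 i) [1..<Suc m]) (not_of_type Ps \<pi>)))"

lemma sat_at_most:
  assumes "n > 0"
  shows "sat n M \<sigma> (at_most Ps \<pi> m) \<longleftrightarrow> type_count (set Ps) n M \<pi> \<le> m"
proof -
  define S where "S = {a \<in> {1..n}. \<forall>P\<in>set Ps. a \<in> M P \<longleftrightarrow> P \<in> \<pi>}"
  have "finite S"
    by (simp add: S_def)
  have body: "sat n M \<sigma>' (All 0 (Ors (map (\<lambda>i. Eq 0 i) [1..<Suc m]) (not_of_type Ps \<pi>)))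
      \<longleftrightarrow> S \<subseteq> \<sigma>' ` {1..m}" for \<sigma>'
  proof -
    have "sat n M (\<sigma>'(0 := a)) (Ors (map (\<lambda>i. Eq 0 i) [1..<Suc m]) (not_of_type Ps \<pi>))
        \<longleftrightarrow> (a \<in> \<sigma>' ` {1..m} \<or> \<not> (\<forall>P\<in>set Ps. a \<in> M P \<longleftrightarrow> P \<in> \<pi>))" for a
      by (auto simp: sat_Ors sat_not_of_type simp del: upt_Suc)
    then show ?thesis
      unfolding sat.simps S_def by blast
  qed
  have "(\<exists>\<sigma>'. (\<forall>i. i \<notin> {1..m} \<longrightarrow> \<sigma>' i = \<sigma> i) \<and> \<sigma>' ` {1..m} \<subseteq> {1..n} \<and> S \<subseteq> \<sigma>' ` {1..m})
      \<longleftrightarrow> card S \<le> m" (is "?L \<longleftrightarrow> ?R")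
  proof
    assume ?L
    then obtain \<sigma>' where "S \<subseteq> \<sigma>' ` {1..m}"
      by blast
    then show ?R
      using surj_card_le[of "{1..m}" S \<sigma>'] by simp
  next
    assume le: ?R
    obtain f where f: "bij_betw f {1..card S} S"
      using ex_bij_betw_nat_finite_1[OF \<open>finite S\<close>] by blast
    \<comment> \<open>Surplus witnesses get the value 1, which lies in the domain because
      \<open>n > 0\<close>.\<close>
    define \<sigma>' where
      "\<sigma>' i = (if i \<in> {1..card S} then f i else if i \<in> {1..m} then 1 else \<sigma> i)" for i
    have img: "\<sigma>' ` {1..card S} = S"
      using f by (simp add: \<sigma>'_def bij_betw_def)
    have S_sub: "S \<subseteq> \<sigma>' ` {1..m}"
      using le by (subst img[symmetric], intro image_mono) auto
    have "\<sigma>' i \<in> {1..n}" if "i \<in> {1..m}" for i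
    proof (cases "i \<in> {1..card S}")
      case True
      then have "\<sigma>' i \<in> S"
        using img by blast
      then show ?thesis
        by (simp add: S_def)
    next
      case False
      then show ?thesis
        using that assms by (auto simp: \<sigma>'_def)
    qed
    moreover have "\<sigma>' i = \<sigma> i" if "i \<notin> {1..m}" for i
      using that le by (auto simp: \<sigma>'_def)
    ultimately show ?L
      using S_sub by blast
  qed
  then show ?thesis
    unfolding at_most_def sat_ex_block body by (simp add: S_def type_count_def)
qed

text \<open>Each witness costs a quantifier, an equality and a disjunction, hence
  \<open>3 * m\<close>; the single universal quantifier raises the rank to
  \<open>Suc m\<close>.\<close>

lemma at_most_measures:
  "preds (at_most Ps \<pi> m) \<subseteq> set Ps" "fv (at_most Ps \<pi> m) = {}"
  "qrank (at_most Ps \<pi> m) \<le> Suc m" "fo_size (at_most Ps \<pi> m) = 3 * m + 2 * length Ps + 2"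
proof -
  have "qrank (Ors (map (\<lambda>i. Eq 0 i) [1..<Suc m]) (not_of_type Ps \<pi>)) \<le> 0"
    by (rule Ors_measures) (auto simp: not_of_type_measures)
  then show "qrank (at_most Ps \<pi> m) \<le> Suc m"
    by (simp add: at_most_def)
  show "fo_size (at_most Ps \<pi> m) = 3 * m + 2 * length Ps + 2"
    by (simp add: at_most_def Ors_measures not_of_type_measures o_def sum_list_triv del: upt_Suc)
  show "preds (at_most Ps \<pi> m) \<subseteq> set Ps"
    using not_of_type_measures(1)[of Ps \<pi>] by (auto simp: at_most_def Ors_measures)
  show "fv (at_most Ps \<pi> m) = {}"
    by (auto simp: at_most_def Ors_measures not_of_type_measures simp del: upt_Suc)
qed

text \<open>For \<open>m = 0\<close> truncated subtraction would make the second branch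
  contradictory, hence the case split.\<close>

definition exactly :: "'p list \<Rightarrow> 'p set \<Rightarrow> nat \<Rightarrow> 'p fo" where
  "exactly Ps \<pi> m =
     (if m = 0 then at_most Ps \<pi> 0 else And (at_most Ps \<pi> m) (neg (at_most Ps \<pi> (m - 1))))"

lemma sat_exactly:
  "n > 0 \<Longrightarrow> sat n M \<sigma> (exactly Ps \<pi> m) \<longleftrightarrow> type_count (set Ps) n M \<pi> = m"
  by (auto simp: exactly_def sat_at_most)

lemma exactly_measures:
  "preds (exactly Ps \<pi> m) \<subseteq> set Ps" "fv (exactly Ps \<pi> m) = {}"
  "qrank (exactly Ps \<pi> m) \<le> Suc m" "fo_size (exactly Ps \<pi> m) \<le> 6 * m + 4 * length Ps + 2"
  using at_most_measures[of Ps \<pi> m] at_most_measures[of Ps \<pi> "m - 1"]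
  by (auto simp: exactly_def)

text \<open>\<open>All 0 (Eq 0 0)\<close> is truth as a closed formula; it has rank 1, which is
  where \<open>d > 0\<close> enters the rank bound.\<close>

definition has_counts :: "'p list \<Rightarrow> ('p set \<Rightarrow> nat) \<Rightarrow> 'p set list \<Rightarrow> 'p fo" where
  "has_counts Ps c \<pi>s = foldr (\<lambda>\<pi>. And (exactly Ps \<pi> (c \<pi>))) \<pi>s (All 0 (Eq 0 0))"

lemma sat_has_counts:
  "n > 0 \<Longrightarrow> sat n M \<sigma> (has_counts Ps c \<pi>s) \<longleftrightarrow> (\<forall>\<pi>\<in>set \<pi>s. type_count (set Ps) n M \<pi> = c \<pi>)"
  by (induction \<pi>s) (auto simp: has_counts_def sat_exactly)

lemma has_counts_measures:
  "preds (has_counts Ps c \<pi>s) \<subseteq> set Ps" "fv (has_counts Ps c \<pi>s) = {}"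
  "(\<And>\<pi>. \<pi> \<in> set \<pi>s \<Longrightarrow> c \<pi> < d) \<Longrightarrow> d > 0 \<Longrightarrow> qrank (has_counts Ps c \<pi>s) \<le> d"
  "fo_size (has_counts Ps c \<pi>s) \<le> 6 * (\<Sum>\<pi>\<leftarrow>\<pi>s. c \<pi>) + (4 * length Ps + 3) * length \<pi>s + 2"
proof -
  show "fo_size (has_counts Ps c \<pi>s) \<le> 6 * (\<Sum>\<pi>\<leftarrow>\<pi>s. c \<pi>) + (4 * length Ps + 3) * length \<pi>s + 2"
  proof (induction \<pi>s)
    case (Cons \<pi> \<pi>s)
    then show ?case
      using exactly_measures(4)[of Ps \<pi> "c \<pi>"] by (simp add: has_counts_def)
  qed (simp add: has_counts_def)
  show "qrank (has_counts Ps c \<pi>s) \<le> d" if "\<And>\<pi>. \<pi> \<in> set \<pi>s \<Longrightarrow> c \<pi> < d" "d > 0"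
    using that
  proof (induction \<pi>s)
    case (Cons \<pi> \<pi>s)
    have "Suc (c \<pi>) \<le> d"
      using Cons.prems by (simp add: Suc_leI)
    then show ?case
      using Cons exactly_measures(3)[of Ps \<pi> "c \<pi>"] by (auto simp: has_counts_def)
  qed (simp add: has_counts_def)
  show "preds (has_counts Ps c \<pi>s) \<subseteq> set Ps"
    using exactly_measures(1)[of Ps] by (induction \<pi>s) (auto simp: has_counts_def)
  show "fv (has_counts Ps c \<pi>s) = {}"
    by (induction \<pi>s) (auto simp: has_counts_def exactly_measures)
qed

text \<open>Below the threshold \<open>d\<close>, equivalence means equality of counts. The count of
  \<open>\<pi>\<^sub>0\<close>, which may reach \<open>d\<close>, follows from the others because
  all counts add up to \<open>n\<close>.\<close>

lemma d_equiv_iff_counts_eq: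
  assumes "finite \<tau>" "\<pi>\<^sub>0 \<subseteq> \<tau>"
    and small: "\<And>\<pi>. \<pi> \<in> Pow \<tau> - {\<pi>\<^sub>0} \<Longrightarrow> type_count \<tau> n M \<pi> < d"
  shows "d_equiv d \<tau> n M M' \<longleftrightarrow>
    (\<forall>\<pi>\<in>Pow \<tau> - {\<pi>\<^sub>0}. type_count \<tau> n M' \<pi> = type_count \<tau> n M \<pi>)"
proof
  assume equiv: "d_equiv d \<tau> n M M'"
  show "\<forall>\<pi>\<in>Pow \<tau> - {\<pi>\<^sub>0}. type_count \<tau> n M' \<pi> = type_count \<tau> n M \<pi>"
  proof
    fix \<pi> assume \<pi>: "\<pi> \<in> Pow \<tau> - {\<pi>\<^sub>0}"
    then have "\<pi> \<subseteq> \<tau>"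
      by simp
    from equiv[unfolded d_equiv_iff, rule_format, OF this] small[OF \<pi>]
    show "type_count \<tau> n M' \<pi> = type_count \<tau> n M \<pi>"
      by linarith
  qed
next
  assume eq: "\<forall>\<pi>\<in>Pow \<tau> - {\<pi>\<^sub>0}. type_count \<tau> n M' \<pi> = type_count \<tau> n M \<pi>"
  have "type_count \<tau> n K \<pi>\<^sub>0 + (\<Sum>\<pi>\<in>Pow \<tau> - {\<pi>\<^sub>0}. type_count \<tau> n K \<pi>) = n" for K
    using assms sum_type_count[OF assms(1), of n K]
    by (subst sum.remove[symmetric]) auto
  then have "type_count \<tau> n M' \<pi>\<^sub>0 = type_count \<tau> n M \<pi>\<^sub>0"
    using eq by (metis (mono_tags, lifting) add_right_cancel sum.cong)
  then show "d_equiv d \<tau> n M M'"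
    using eq unfolding d_equiv_iff by (metis DiffI PowI singletonD)
qed

theorem theorem10:
  fixes \<tau> :: "'p set" and d n h :: nat and M :: "'p \<Rightarrow> nat set"
  assumes "finite \<tau>"
    and "d \<ge> 1"
    and "M \<in> models \<tau> n"
    and "h \<in> {1..d - 1}"
    and "boltzmann_entropy d \<tau> n M < log 2 (real (n choose h))"
  shows "description_complexity d \<tau> n M < enat (6 * h + c_voc \<tau>)"
proof -
  let ?c = "type_count \<tau> n M"
  have "M \<in> d_class d \<tau> n M"
    using assms(3) by (simp add: d_class_def d_equiv_iff)
  then have pos: "card (d_class d \<tau> n M) > 0"
    using finite_models[OF assms(1)] by (auto simp: d_class_def card_gt_0_iff)
  \<comment> \<open>For \<open>h > n\<close> the right-hand side of the hypothesis is the junk value \<open>log 2 0 = 0\<close>.\<close>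
  have choose_pos: "n choose h > 0"
  proof (rule ccontr)
    assume "\<not> n choose h > 0"
    moreover have "boltzmann_entropy d \<tau> n M \<ge> 0"
      using pos by (simp add: boltzmann_entropy_def Suc_le_eq)
    ultimately show False
      using assms(5) by (simp add: not_less binomial_eq_0 log_def)
  qed
  then have "h \<le> n"
    by simp
  \<comment> \<open>The logarithm is strictly increasing on positive arguments, so both positivity
    facts are used here.\<close>
  have "card (d_class d \<tau> n M) < n choose h"
    using assms(5) pos choose_pos by (simp add: boltzmann_entropy_def)
  then obtain \<pi>\<^sub>0 where \<pi>\<^sub>0: "\<pi>\<^sub>0 \<subseteq> \<tau>" "n - ?c \<pi>\<^sub>0 < h"
    using dominant_type[OF assms(1) \<open>h \<le> n\<close>] assms(4) by auto
  have n: "n > 0" and hd: "h < d"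
    using assms(4) \<open>h \<le> n\<close> by auto
  define T where "T = Pow \<tau> - {\<pi>\<^sub>0}"
  have "finite T"
    using assms(1) by (simp add: T_def)
  have "?c \<pi>\<^sub>0 + (\<Sum>\<pi>\<in>T. ?c \<pi>) = n"
    using assms(1) \<pi>\<^sub>0 sum_type_count[OF assms(1), of n M]
    by (subst T_def, subst sum.remove[symmetric]) auto
  then have sum: "(\<Sum>\<pi>\<in>T. ?c \<pi>) < h"
    using \<pi>\<^sub>0 by linarith
  \<comment> \<open>A single count is at most the sum, which is below \<open>h < d\<close>; this
    gives both the rank bound and the exactness of the counts.\<close>
  have small: "?c \<pi> < d" if "\<pi> \<in> T" for \<pi>
    using member_le_sum[OF that, of ?c] sum hd \<open>finite T\<close> by auto
  obtain Ps where Ps: "set Ps = \<tau>" "distinct Ps"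
    using finite_distinct_list[OF assms(1)] by blast
  obtain \<pi>s where \<pi>s: "set \<pi>s = T" "distinct \<pi>s"
    using finite_distinct_list[OF \<open>finite T\<close>] by blast
  define \<phi> where "\<phi> = has_counts Ps ?c \<pi>s"
  have "true_in n M' \<phi> \<longleftrightarrow> d_equiv d \<tau> n M M'" for M'
  proof -
    \<comment> \<open>Truth quantifies over assignments into the domain, so it would hold vacuously
      if there were none; a constant assignment exists because \<open>n > 0\<close>.\<close>
    have "true_in n M' \<phi> \<longleftrightarrow> (\<exists>\<sigma>. range \<sigma> \<subseteq> {1..n}) \<longrightarrow> (\<forall>\<pi>\<in>T. type_count \<tau> n M' \<pi> = ?c \<pi>)"
      unfolding true_in_def \<phi>_def sat_has_counts[OF n] Ps \<pi>s by blast
    moreover have "(\<exists>\<sigma>::nat \<Rightarrow> nat. range \<sigma> \<subseteq> {1..n})"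
      using n by (intro exI[of _ "\<lambda>_. 1"]) auto
    ultimately show ?thesis
      using d_equiv_iff_counts_eq[OF assms(1) \<pi>\<^sub>0(1), of n M d M'] small by (auto simp: T_def)
  qed
  moreover have "\<phi> \<in> FO_sentences d \<tau>"
    using has_counts_measures(1,2)[of Ps ?c \<pi>s] has_counts_measures(3)[of \<pi>s ?c d Ps] assms(2)
      small Ps \<pi>s by (simp add: FO_sentences_def \<phi>_def)
  ultimately have "description_complexity d \<tau> n M \<le> enat (fo_size \<phi>)"
    unfolding description_complexity_def by (intro INF_lower) auto
  also have "fo_size \<phi> < 6 * h + c_voc \<tau>"
  proof -
    let ?k = "card \<tau>"
    have "length Ps = ?k" and "length \<pi>s = card T"
      using Ps \<pi>s distinct_card by metis+
    moreover have "(\<Sum>\<pi>\<leftarrow>\<pi>s. ?c \<pi>) = (\<Sum>\<pi>\<in>T. ?c \<pi>)"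
      using \<pi>s by (simp add: sum_list_distinct_conv_sum_set)
    ultimately have "fo_size \<phi> \<le> 6 * (\<Sum>\<pi>\<in>T. ?c \<pi>) + (4 * ?k + 3) * card T + 2"
      using has_counts_measures(4)[of Ps ?c \<pi>s] by (simp add: \<phi>_def)
    moreover have "card T = 2 ^ ?k - 1"
      using assms(1) \<pi>\<^sub>0 by (simp add: T_def card_Pow)
    \<comment> \<open>For \<open>?k > 0\<close> one has \<open>4 * ?k + 3 \<le> 15 * ?k\<close>; for
      \<open>?k = 0\<close> no type other than \<open>\<pi>\<^sub>0\<close> exists and both sides
      vanish. The additive 2 is absorbed by the strict bound on the sum, which saves at least
      6.\<close>
    moreover have "(4 * ?k + 3) * (2 ^ ?k - 1) \<le> 15 * ?k * 2 ^ ?k"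
    proof (cases "?k = 0")
      case False
      then show ?thesis
        by (intro mult_le_mono) auto
    qed simp
    ultimately show ?thesis
      using sum by (simp add: c_voc_def)
  qed
  finally show ?thesis
    by simp
qed

end
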